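(* Let $X$ be a (non-empty) metric space, let $\mathcal{I}$ be a non-trivial admissible ideal of $\mathbb{N}$, and let $\Phi$ be a class of real-valued functions on $X$. For each of the following six properties, if $\Phi$ has that property then so does the class $\Phi^{\mathcal{I}^*\text{-}\alpha\text{-}s.u.e.}$: being a lattice, a translation lattice, a congruence lattice, a weakly affine lattice, an affine lattice, a subtractive lattice.
   Context: An ideal of $\mathbb{N}$ (positive integers) is a family $\mathcal{I}\subset 2^{\mathbb{N}}$ such that $A,B\in\mathcal{I}$ implies $A\cup B\in\mathcal{I}$, and $A\in\mathcal{I}$, $B\subset A$ implies $B\in\mathcal{I}$. It is non-trivial if $\mathbb{N}\notin\mathcal{I}$ and admissible if $\{n\}\in\mathcal{I}$ for every $n\in\mathbb{N}$. The associated filter is $\mathcal{F}(\mathcal{I})=\{\mathbb{N}\setminus A: A\in\mathcal{I}\}$. For functions $f,f_n:X\to\mathbb{R}$ ($n\in\mathbb{N}$), $\{f_n\}$ converges $\mathcal{I}^*$-$\alpha$-strongly uniformly equally to $f$ (written $f_n\xrightarrow{\mathcal{I}^*\text{-}\alpha\text{-}s.u.e.} f$) if there exist a convergent series $\sum_{n=1}^\infty\varepsilon_n$ of positive reals, a set $M\in\mathcal{F}(\mathcal{I})$ and $n_0\in\mathbb{N}$ such that for every $x\in X$ and every sequence $(x_n)_{n\in M}$ in $X$ converging to $x$ one has $|\{n\in M: |f_n(x_n)-f(x)|\ge\varepsilon_n\}|\le n_0$ (outer bars denote cardinality). $\Phi^{\mathcal{I}^*\text{-}\alpha\text{-}s.u.e.}$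 is the class of all functions $f:X\to\mathbb{R}$ for which there is a sequence $\{f_n\}$ in $\Phi$ with $f_n\xrightarrow{\mathcal{I}^*\text{-}\alpha\text{-}s.u.e.} f$. A class $\Phi$ of real-valued functions on $X$ is: a lattice if it contains all constant functions and $f,g\in\Phi$ implies $\max(f,g)\in\Phi$ and $\min(f,g)\in\Phi$; a translation lattice if it is a lattice and $f\in\Phi$, $c\in\mathbb{R}$ implies $f+c\in\Phi$; a congruence lattice if it is a translation lattice and $f\in\Phi$ implies $-f\in\Phi$; a weakly affine lattice if it is a congruence lattice and there is an unbounded set $C\subset(0,\infty)$ such that $f\in\Phi$, $c\in C$ implies $cf\in\Phi$; an affine lattice if it is a congruence lattice and $f\in\Phi$, $c\in\mathbb{R}$ implies $cf\in\Phi$; a subtractive lattice if it is a lattice and $f,g\in\Phi$ implies $f-g\in\Phi$. *)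

theory Defs
  imports "HOL-Analysis.Analysis"
begin

text \<open>
  The index set of the source is the set of positive integers; it is rendered as the set
  \<open>pos_nats\<close> of positive elements of \<^typ>\<open>nat\<close>. Values of a sequence at \<open>0\<close> are never used.
\<close>

abbreviation pos_nats :: "nat set" where
  "pos_nats \<equiv> {1..}"

definition set_ideal :: "nat set set \<Rightarrow> bool" where
  "set_ideal I \<longleftrightarrow> I \<subseteq> Pow pos_nats
     \<and> (\<forall>A\<in>I. \<forall>B\<in>I. A \<union> B \<in> I)
     \<and> (\<forall>A\<in>I. \<forall>B. B \<subseteq> A \<longrightarrow> B \<in> I)"

definition nontrivial_ideal :: "nat set set \<Rightarrow> bool" where
  "nontrivial_ideal I \<longleftrightarrow> set_ideal I \<and> pos_nats \<notin> I"

definition admissible_ideal :: "nat set set \<Rightarrow> bool" where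
  "admissible_ideal I \<longleftrightarrow> set_ideal I \<and> (\<forall>n\<in>pos_nats. {n} \<in> I)"

definition ideal_filter :: "nat set set \<Rightarrow> nat set set" where
  "ideal_filter I = {pos_nats - A | A. A \<in> I}"

text \<open>
  A sequence indexed by \<open>M\<close> is a function on \<^typ>\<open>nat\<close> of which only the values on \<open>M\<close> matter;
  its convergence is convergence along the trace of \<^const>\<open>sequentially\<close> on \<open>M\<close>.
\<close>

definition converges_along :: "nat set \<Rightarrow> (nat \<Rightarrow> 'a::metric_space) \<Rightarrow> 'a \<Rightarrow> bool" where
  "converges_along M x a \<longleftrightarrow> (x \<longlongrightarrow> a) (inf sequentially (principal M))"

lemma converges_along_iff:
  "converges_along M x a \<longleftrightarrow> (\<forall>e>0. \<exists>N. \<forall>n\<in>M. n \<ge> N \<longrightarrow> dist (x n) a < e)"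
  unfolding converges_along_def tendsto_iff eventually_inf_principal eventually_sequentially
  by blast

text \<open>
  Finiteness is stated separately in the bound on the exceptional set because \<^const>\<open>card\<close>
  is \<open>0\<close> on infinite sets.
\<close>

definition Istar_alpha_sue ::
  "nat set set \<Rightarrow> (nat \<Rightarrow> 'a::metric_space \<Rightarrow> real) \<Rightarrow> ('a \<Rightarrow> real) \<Rightarrow> bool" where
  "Istar_alpha_sue I f g \<longleftrightarrow>
     (\<exists>\<epsilon> :: nat \<Rightarrow> real. \<exists>M. \<exists>n\<^sub>0\<in>pos_nats.
        (\<forall>n\<in>pos_nats. \<epsilon> n > 0) \<and> summable (\<lambda>n. \<epsilon> (Suc n)) \<and> M \<in> ideal_filter I \<and>
        (\<forall>a x. converges_along M x a \<longrightarrow>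
           finite {n \<in> M. \<bar>f n (x n) - g a\<bar> \<ge> \<epsilon> n} \<and>
           card {n \<in> M. \<bar>f n (x n) - g a\<bar> \<ge> \<epsilon> n} \<le> n\<^sub>0))"

definition Istar_alpha_sue_class ::
  "nat set set \<Rightarrow> ('a::metric_space \<Rightarrow> real) set \<Rightarrow> ('a \<Rightarrow> real) set" where
  "Istar_alpha_sue_class I \<Phi> =
     {g. \<exists>f. (\<forall>n\<in>pos_nats. f n \<in> \<Phi>) \<and> Istar_alpha_sue I f g}"

definition fun_lattice :: "('a \<Rightarrow> real) set \<Rightarrow> bool" where
  "fun_lattice \<Phi> \<longleftrightarrow> (\<forall>c. (\<lambda>x. c) \<in> \<Phi>)
     \<and> (\<forall>f\<in>\<Phi>. \<forall>g\<in>\<Phi>. (\<lambda>x. max (f x) (g x)) \<in> \<Phi> \<and> (\<lambda>x. min (f x) (g x)) \<in> \<Phi>)"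

definition translation_lattice :: "('a \<Rightarrow> real) set \<Rightarrow> bool" where
  "translation_lattice \<Phi> \<longleftrightarrow> fun_lattice \<Phi> \<and> (\<forall>f\<in>\<Phi>. \<forall>c. (\<lambda>x. f x + c) \<in> \<Phi>)"

definition congruence_lattice :: "('a \<Rightarrow> real) set \<Rightarrow> bool" where
  "congruence_lattice \<Phi> \<longleftrightarrow> translation_lattice \<Phi> \<and> (\<forall>f\<in>\<Phi>. (\<lambda>x. - f x) \<in> \<Phi>)"

definition weakly_affine_lattice :: "('a \<Rightarrow> real) set \<Rightarrow> bool" where
  "weakly_affine_lattice \<Phi> \<longleftrightarrow> congruence_lattice \<Phi>
     \<and> (\<exists>C. C \<subseteq> {0<..} \<and> \<not> bounded C \<and> (\<forall>f\<in>\<Phi>. \<forall>c\<in>C. (\<lambda>x. c * f x) \<in> \<Phi>))"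

definition affine_lattice :: "('a \<Rightarrow> real) set \<Rightarrow> bool" where
  "affine_lattice \<Phi> \<longleftrightarrow> congruence_lattice \<Phi> \<and> (\<forall>f\<in>\<Phi>. \<forall>c. (\<lambda>x. c * f x) \<in> \<Phi>)"

definition subtractive_lattice :: "('a \<Rightarrow> real) set \<Rightarrow> bool" where
  "subtractive_lattice \<Phi> \<longleftrightarrow> fun_lattice \<Phi> \<and> (\<forall>f\<in>\<Phi>. \<forall>g\<in>\<Phi>. (\<lambda>x. f x - g x) \<in> \<Phi>)"

end

theory Submission
  imports Defs
begin

text \<open>
  Every closure property in question concerns composition with a Lipschitz map of two real
  variables. If \<open>f\<^sub>n\<close> and \<open>g\<^sub>n\<close> are approximated up to \<open>\<alpha>\<^sub>n\<close> and \<open>\<beta>\<^sub>n\<close> along \<open>M\<close> and \<open>N\<close>, then the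
  composition with a map of Lipschitz constant \<open>L\<close> is approximated up to \<open>L (\<alpha>\<^sub>n + \<beta>\<^sub>n)\<close> along
  \<open>M \<inter> N\<close>, and its exceptional set lies in the union of the two given ones. A sequence converging
  along \<open>M \<inter> N\<close> is tested against the hypotheses by padding it with its limit.
\<close>

lemma pos_nats_mem_ideal_filter:
  assumes "admissible_ideal I"
  shows "pos_nats \<in> ideal_filter I"
proof -
  \<comment> \<open>\<open>set_ideal\<close> by itself admits the empty family, so that the empty
    set lies in \<open>I\<close> has to come from admissibility: it is a subset of the member
    {1}.\<close>
  have "{1} \<in> I" and "set_ideal I"
    using assms by (auto simp: admissible_ideal_def)
  then have "{} \<in> I"
    unfolding set_ideal_def by blast
  then show ?thesis
    unfolding ideal_filter_def by blast
qed

lemma Int_mem_ideal_filter: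
  assumes "set_ideal I" "M \<in> ideal_filter I" "N \<in> ideal_filter I"
  shows "M \<inter> N \<in> ideal_filter I"
proof -
  obtain A B where "A \<in> I" "B \<in> I" and M: "M = pos_nats - A" and N: "N = pos_nats - B"
    using assms(2,3) unfolding ideal_filter_def by blast
  then have "A \<union> B \<in> I"
    using assms(1) unfolding set_ideal_def by blast
  moreover have "M \<inter> N = pos_nats - (A \<union> B)"
    unfolding M N by blast
  ultimately show ?thesis
    unfolding ideal_filter_def by blast
qed

text \<open>At indices of \<open>M\<close> outside \<open>N\<close> the padded sequence is at
  distance 0 from \<open>a\<close>, so any threshold index that serves \<open>x\<close> along the
  intersection still serves.\<close>

lemma converges_along_pad:
  assumes "converges_along (M \<inter> N) x a"
  shows "converges_along M (\<lambda>n. if n \<in> N then x n else a) a"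
  using assms unfolding converges_along_iff by (metis IntI dist_self)

lemma Istar_alpha_sue_const:
  assumes "admissible_ideal I"
  shows "Istar_alpha_sue I (\<lambda>n x. c) (\<lambda>x. c)"
proof -
  \<comment> \<open>The deviation |c - c| is 0, so an index could be exceptional only if (1/2)^n
    \<le> 0. Hence the exceptional set is empty for this positive summable sequence.\<close>
  have nonpos: "\<not> (1/2::real) ^ n \<le> 0" for n
    by (simp add: not_le)
  show ?thesis
    unfolding Istar_alpha_sue_def
  proof (intro exI bexI conjI)
    show "\<forall>n\<in>pos_nats. (1/2::real) ^ n > 0" and "1 \<in> pos_nats"
      by auto
    show "summable (\<lambda>n. (1/2::real) ^ Suc n)"
      by (simp add: summable_geometric)
    show "pos_nats \<in> ideal_filter I"
      by (rule pos_nats_mem_ideal_filter) fact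
  qed (simp_all add: nonpos)
qed

lemma Istar_alpha_sue_lipschitz:
  assumes I: "set_ideal I"
    and f: "Istar_alpha_sue I fs f" and g: "Istar_alpha_sue I gs g"
    and L: "L > 0" "\<And>a b c d. \<bar>h a b - h c d\<bar> \<le> L * (\<bar>a - c\<bar> + \<bar>b - d\<bar>)"
  shows "Istar_alpha_sue I (\<lambda>n x. h (fs n x) (gs n x)) (\<lambda>x. h (f x) (g x))"
proof -
  obtain \<alpha> M p where p: "p \<in> pos_nats" and \<alpha>: "\<forall>n\<in>pos_nats. \<alpha> n > 0" "summable (\<lambda>n. \<alpha> (Suc n))"
    and M: "M \<in> ideal_filter I"
    and fM: "\<And>a x. converges_along M x a \<Longrightarrow>
      finite {n \<in> M. \<bar>fs n (x n) - f a\<bar> \<ge> \<alpha> n} \<and> card {n \<in> M. \<bar>fs n (x n) - f a\<bar> \<ge> \<alpha> n} \<le> p"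
    using f unfolding Istar_alpha_sue_def by blast
  obtain \<beta> N q where q: "q \<in> pos_nats" and \<beta>: "\<forall>n\<in>pos_nats. \<beta> n > 0" "summable (\<lambda>n. \<beta> (Suc n))"
    and N: "N \<in> ideal_filter I"
    and gN: "\<And>a x. converges_along N x a \<Longrightarrow>
      finite {n \<in> N. \<bar>gs n (x n) - g a\<bar> \<ge> \<beta> n} \<and> card {n \<in> N. \<bar>gs n (x n) - g a\<bar> \<ge> \<beta> n} \<le> q"
    using g unfolding Istar_alpha_sue_def by blast
  define \<gamma> where "\<gamma> n = L * (\<alpha> n + \<beta> n)" for n
  have exceptional: "finite {n \<in> M \<inter> N. \<bar>h (fs n (x n)) (gs n (x n)) - h (f a) (g a)\<bar> \<ge> \<gamma> n} \<and>
      card {n \<in> M \<inter> N. \<bar>h (fs n (x n)) (gs n (x n)) - h (f a) (g a)\<bar> \<ge> \<gamma> n} \<le> p + q"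
    (is "finite ?E \<and> card ?E \<le> _") if x: "converges_along (M \<inter> N) x a" for a x
  proof -
    \<comment> \<open>\<open>fM\<close> tests sequences along all of \<open>M\<close> and
      \<open>gN\<close> along all of \<open>N\<close>, so each gets its own padding. Both agree with
      \<open>x\<close> on the intersection, where the exceptional set lies.\<close>
    define y where "y = (\<lambda>n. if n \<in> N then x n else a)"
    define z where "z = (\<lambda>n. if n \<in> M then x n else a)"
    define A where "A = {n \<in> M. \<bar>fs n (y n) - f a\<bar> \<ge> \<alpha> n}"
    define B where "B = {n \<in> N. \<bar>gs n (z n) - g a\<bar> \<ge> \<beta> n}"
    have "converges_along M y a" "converges_along N z a"
      using converges_along_pad[of M N x a] converges_along_pad[of N M x a] x
      by (simp_all add: y_def z_def Int_commute)
    then have A: "finite A" "card A \<le> p" and B: "finite B" "card B \<le> q"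
      using fM gN by (simp_all add: A_def B_def)
    have "?E \<subseteq> A \<union> B"
    proof
      fix n assume n: "n \<in> ?E"
      then have yz: "y n = x n" "z n = x n"
        by (simp_all add: y_def z_def)
      \<comment> \<open>Once L > 0 is cancelled, the two deviations sum to at least \<alpha> n +
        \<beta> n, so they cannot both stay below their own thresholds.\<close>
      have "L * (\<alpha> n + \<beta> n) \<le> L * (\<bar>fs n (x n) - f a\<bar> + \<bar>gs n (x n) - g a\<bar>)"
        using n L(2)[of "fs n (x n)" "gs n (x n)" "f a" "g a"] by (simp add: \<gamma>_def)
      then have "\<alpha> n + \<beta> n \<le> \<bar>fs n (x n) - f a\<bar> + \<bar>gs n (x n) - g a\<bar>"
        using L(1) by simp
      then have "\<alpha> n \<le> \<bar>fs n (x n) - f a\<bar> \<or> \<beta> n \<le> \<bar>gs n (x n) - g a\<bar>"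
        by linarith
      then show "n \<in> A \<union> B"
        using n by (auto simp: A_def B_def yz)
    qed
    moreover have "card (A \<union> B) \<le> p + q"
      using card_Un_le[of A B] A B by linarith
    ultimately show ?thesis
      using A(1) B(1) by (meson card_mono finite_UnI finite_subset le_trans)
  qed
  show ?thesis
    unfolding Istar_alpha_sue_def
  proof (intro exI bexI conjI allI impI)
    show "p + q \<in> pos_nats"
      using p by simp
    show "\<forall>n\<in>pos_nats. \<gamma> n > 0"
      using \<alpha>(1) \<beta>(1) L(1) by (simp add: \<gamma>_def add_pos_pos)
    show "summable (\<lambda>n. \<gamma> (Suc n))"
      using \<alpha>(2) \<beta>(2) unfolding \<gamma>_def by (intro summable_mult summable_add)
    show "M \<inter> N \<in> ideal_filter I"
      using I M N by (rule Int_mem_ideal_filter)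
  qed (use exceptional in auto)
qed

lemma Istar_alpha_sue_class_const:
  assumes "admissible_ideal I" "(\<lambda>x. c) \<in> \<Phi>"
  shows "(\<lambda>x. c) \<in> Istar_alpha_sue_class I \<Phi>"
  using Istar_alpha_sue_const[OF assms(1), of c] assms(2) unfolding Istar_alpha_sue_class_def
  by (auto intro!: exI[of _ "\<lambda>n x. c"])

lemma Istar_alpha_sue_class_lipschitz:
  assumes "set_ideal I"
    and "f \<in> Istar_alpha_sue_class I \<Phi>" "g \<in> Istar_alpha_sue_class I \<Phi>"
    and "\<And>f g. f \<in> \<Phi> \<Longrightarrow> g \<in> \<Phi> \<Longrightarrow> (\<lambda>x. h (f x) (g x)) \<in> \<Phi>"
    and "L > 0" "\<And>a b c d. \<bar>h a b - h c d\<bar> \<le> L * (\<bar>a - c\<bar> + \<bar>b - d\<bar>)"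
  shows "(\<lambda>x. h (f x) (g x)) \<in> Istar_alpha_sue_class I \<Phi>"
proof -
  obtain fs gs where "\<forall>n\<in>pos_nats. fs n \<in> \<Phi>" "Istar_alpha_sue I fs f"
    and "\<forall>n\<in>pos_nats. gs n \<in> \<Phi>" "Istar_alpha_sue I gs g"
    using assms(2,3) unfolding Istar_alpha_sue_class_def by blast
  then have "\<forall>n\<in>pos_nats. (\<lambda>x. h (fs n x) (gs n x)) \<in> \<Phi>"
    and "Istar_alpha_sue I (\<lambda>n x. h (fs n x) (gs n x)) (\<lambda>x. h (f x) (g x))"
    using assms(4) Istar_alpha_sue_lipschitz[OF assms(1) _ _ assms(5,6)] by blast+
  then show ?thesis
    unfolding Istar_alpha_sue_class_def
    by (auto intro!: exI[of _ "\<lambda>n x. h (fs n x) (gs n x)"])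
qed

text \<open>Translation, negation and scaling are handled at once, as a binary map that ignores its
  second argument, with \<open>f\<close> in both places. The constant is |k| + 1 because a Lipschitz
  constant must be positive even for k = 0.\<close>

lemma Istar_alpha_sue_class_affine:
  assumes "set_ideal I" and f: "f \<in> Istar_alpha_sue_class I \<Phi>"
    and "\<And>f. f \<in> \<Phi> \<Longrightarrow> (\<lambda>x. k * f x + c) \<in> \<Phi>"
  shows "(\<lambda>x. k * f x + c) \<in> Istar_alpha_sue_class I \<Phi>"
proof (rule Istar_alpha_sue_class_lipschitz[OF assms(1) f f, where h = "\<lambda>a _. k * a + c" and L = "\<bar>k\<bar> + 1"])
  show "\<bar>k * a + c - (k * a' + c)\<bar> \<le> (\<bar>k\<bar> + 1) * (\<bar>a - a'\<bar> + \<bar>b - b'\<bar>)" for a b a' b'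
  proof -
    have "\<bar>k * a + c - (k * a' + c)\<bar> = \<bar>k\<bar> * \<bar>a - a'\<bar>"
      by (simp add: abs_mult[symmetric] right_diff_distrib)
    also have "\<dots> \<le> (\<bar>k\<bar> + 1) * (\<bar>a - a'\<bar> + \<bar>b - b'\<bar>)"
      by (intro mult_mono) auto
    finally show ?thesis .
  qed
qed (use assms(3) in auto)

theorem theorem3p4:
  fixes \<Phi> :: "('a::metric_space \<Rightarrow> real) set" and I :: "nat set set"
  assumes "nontrivial_ideal I" and "admissible_ideal I"
  shows "(fun_lattice \<Phi> \<longrightarrow> fun_lattice (Istar_alpha_sue_class I \<Phi>))
    \<and> (translation_lattice \<Phi> \<longrightarrow> translation_lattice (Istar_alpha_sue_class I \<Phi>))
    \<and> (congruence_lattice \<Phi> \<longrightarrow> congruence_lattice (Istar_alpha_sue_class I \<Phi>))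
    \<and> (weakly_affine_lattice \<Phi> \<longrightarrow> weakly_affine_lattice (Istar_alpha_sue_class I \<Phi>))
    \<and> (affine_lattice \<Phi> \<longrightarrow> affine_lattice (Istar_alpha_sue_class I \<Phi>))
    \<and> (subtractive_lattice \<Phi> \<longrightarrow> subtractive_lattice (Istar_alpha_sue_class I \<Phi>))"
proof -
  let ?\<Psi> = "Istar_alpha_sue_class I \<Phi>"
  have I: "set_ideal I"
    using assms by (simp add: admissible_ideal_def)
  \<comment> \<open>The constant 1 suffices for maximum, minimum and difference, each of which moves
    by at most the sum of the changes in its arguments.\<close>
  note lipschitz = Istar_alpha_sue_class_lipschitz[OF I, where L = 1]
    and affine = Istar_alpha_sue_class_affine[OF I]
  have lattice: "fun_lattice ?\<Psi>" if "fun_lattice \<Phi>"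
    using that unfolding fun_lattice_def
    by (auto intro!: Istar_alpha_sue_class_const[OF assms(2)] lipschitz[where h = max]
        lipschitz[where h = min])
  have translation: "translation_lattice ?\<Psi>" if "translation_lattice \<Phi>"
    using that lattice unfolding translation_lattice_def
    by (auto intro!: affine[where k = 1, simplified])
  have congruence: "congruence_lattice ?\<Psi>" if "congruence_lattice \<Phi>"
    using that translation affine[where k = "-1" and c = 0] unfolding congruence_lattice_def by auto
  \<comment> \<open>Stated for one factor \<open>c\<close> at a time, so that the unbounded set of
    factors given for \<Phi> serves unchanged for the new class.\<close>
  have scaling: "(\<lambda>x. c * f x) \<in> ?\<Psi>" if "\<forall>f\<in>\<Phi>. (\<lambda>x. c * f x) \<in> \<Phi>" "f \<in> ?\<Psi>" for c f
    using that affine[where k = c and c = 0] by auto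
  have "weakly_affine_lattice ?\<Psi>" if "weakly_affine_lattice \<Phi>"
    using that congruence scaling unfolding weakly_affine_lattice_def by meson
  moreover have "affine_lattice ?\<Psi>" if "affine_lattice \<Phi>"
    using that congruence scaling unfolding affine_lattice_def by blast
  moreover have "subtractive_lattice ?\<Psi>" if "subtractive_lattice \<Phi>"
    using that lattice unfolding subtractive_lattice_def
    by (auto intro!: lipschitz[where h = minus])
  ultimately show ?thesis
    using lattice translation congruence by blast
qed

end
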